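(* Let $\phi:R\rightarrow R'$ be a morphism of commutative rings. Then $\phi$ lifts idempotents if and only if $H_{0}(\phi):H_{0}(R)\rightarrow H_{0}(R')$ is surjective. The map $H_{0}(\phi)$ is injective if and only if $\operatorname{Ker}\phi$ has no nonzero idempotents.
   Context: All rings are commutative with $1$. A morphism of rings $\phi:R\rightarrow R'$ lifts idempotents if for every idempotent $e'\in R'$ there exists an idempotent $e\in R$ with $\phi(e)=e'$. For a ring $R$, $H_{0}(R)$ is the ring of all continuous functions $\operatorname{Spec}(R)\rightarrow\mathbb{Z}$ under pointwise addition and multiplication, where $\operatorname{Spec}(R)$ has the Zariski topology and $\mathbb{Z}$ the discrete topology. For a morphism of rings $\phi:R\rightarrow R'$, let $\phi^{\ast}:\operatorname{Spec}(R')\rightarrow\operatorname{Spec}(R)$, $\mathfrak{p}\mapsto\phi^{-1}(\mathfrak{p})$; then $H_{0}(\phi):H_{0}(R)\rightarrow H_{0}(R')$ is the ring morphism $\psi\mapsto\psi\circ\phi^{\ast}$. *)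

theory Defs
  imports "HOL-Analysis.Analysis" "HOL-Algebra.Algebra"
begin

definition idempotents :: "('a, 'm) ring_scheme \<Rightarrow> 'a set" where
  "idempotents R = {e \<in> carrier R. e \<otimes>\<^bsub>R\<^esub> e = e}"

definition lifts_idempotents ::
    "('a, 'm) ring_scheme \<Rightarrow> ('b, 'n) ring_scheme \<Rightarrow> ('a \<Rightarrow> 'b) \<Rightarrow> bool" where
  "lifts_idempotents R R' \<phi> \<longleftrightarrow>
     (\<forall>e' \<in> idempotents R'. \<exists>e \<in> idempotents R. \<phi> e = e')"

definition Spec :: "('a, 'm) ring_scheme \<Rightarrow> 'a set set" where
  "Spec R = {P. primeideal P R}"

definition zero_locus :: "('a, 'm) ring_scheme \<Rightarrow> 'a set \<Rightarrow> 'a set set" where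
  "zero_locus R E = {P \<in> Spec R. E \<subseteq> P}"

definition zariski :: "('a, 'm) ring_scheme \<Rightarrow> 'a set topology" where
  "zariski R = topology (\<lambda>U. \<exists>E. E \<subseteq> carrier R \<and> U = Spec R - zero_locus R E)"

lemma Spec_Diff_zero_locus: "Spec R - zero_locus R E = {P \<in> Spec R. \<not> E \<subseteq> P}"
  by (auto simp: zero_locus_def)

lemma istopology_zariski:
  "istopology (\<lambda>U. \<exists>E. E \<subseteq> carrier R \<and> U = Spec R - zero_locus R E)"
  unfolding istopology_def Spec_Diff_zero_locus
proof (intro conjI allI impI)
  fix U V
  assume "\<exists>E\<subseteq>carrier R. U = {P \<in> Spec R. \<not> E \<subseteq> P}"
    and "\<exists>E\<subseteq>carrier R. V = {P \<in> Spec R. \<not> E \<subseteq> P}"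
  then obtain E F where E: "E \<subseteq> carrier R" "U = {P \<in> Spec R. \<not> E \<subseteq> P}"
    and F: "F \<subseteq> carrier R" "V = {P \<in> Spec R. \<not> F \<subseteq> P}"
    by blast
  define G where "G = {x \<otimes>\<^bsub>R\<^esub> y | x y. x \<in> E \<and> y \<in> F}"
  have key: "\<not> G \<subseteq> P \<longleftrightarrow> \<not> E \<subseteq> P \<and> \<not> F \<subseteq> P" if "P \<in> Spec R" for P
  proof -
    interpret primeideal P R using that by (simp add: Spec_def)
    show ?thesis
    proof
      assume "\<not> G \<subseteq> P"
      then obtain x y where xy: "x \<in> E" "y \<in> F" "x \<otimes>\<^bsub>R\<^esub> y \<notin> P"
        unfolding G_def by auto
      then have "x \<notin> P" "y \<notin> P"
        using I_r_closed[of x y] I_l_closed[of y x] E(1) F(1) by auto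
      then show "\<not> E \<subseteq> P \<and> \<not> F \<subseteq> P"
        using xy by auto
    next
      assume "\<not> E \<subseteq> P \<and> \<not> F \<subseteq> P"
      then obtain x y where xy: "x \<in> E" "x \<notin> P" "y \<in> F" "y \<notin> P"
        by auto
      then have "x \<otimes>\<^bsub>R\<^esub> y \<notin> P"
        using I_prime[of x y] E(1) F(1) by auto
      then show "\<not> G \<subseteq> P"
        using xy unfolding G_def by auto
    qed
  qed
  show "\<exists>G\<subseteq>carrier R. U \<inter> V = {P \<in> Spec R. \<not> G \<subseteq> P}"
  proof (cases "Spec R = {}")
    case True
    then show ?thesis using E F by auto
  next
    case False
    then obtain P where "primeideal P R" by (auto simp: Spec_def)
    then interpret primeideal P R .
    have "G \<subseteq> carrier R" using E(1) F(1) unfolding G_def by auto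
    then show ?thesis using E(2) F(2) key by blast
  qed
next
  fix \<K>
  assume "\<forall>K\<in>\<K>. \<exists>E\<subseteq>carrier R. K = {P \<in> Spec R. \<not> E \<subseteq> P}"
  then obtain e where e: "\<And>K. K \<in> \<K> \<Longrightarrow> e K \<subseteq> carrier R \<and> K = {P \<in> Spec R. \<not> e K \<subseteq> P}"
    by metis
  have "\<Union>\<K> = {P \<in> Spec R. \<not> (\<Union>K\<in>\<K>. e K) \<subseteq> P}"
    using e by blast
  moreover have "(\<Union>K\<in>\<K>. e K) \<subseteq> carrier R"
    using e by blast
  ultimately show "\<exists>E\<subseteq>carrier R. \<Union>\<K> = {P \<in> Spec R. \<not> E \<subseteq> P}"
    by blast
qed

lemma openin_zariski:
  "openin (zariski R) U \<longleftrightarrow> (\<exists>E. E \<subseteq> carrier R \<and> U = Spec R - zero_locus R E)"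
  unfolding zariski_def topology_inverse'[OF istopology_zariski] ..

lemma topspace_zariski: "topspace (zariski R) = Spec R"
proof
  show "topspace (zariski R) \<subseteq> Spec R"
    unfolding topspace_def openin_zariski by blast
  have "Spec R = Spec R - zero_locus R (carrier R)"
  proof -
    have "carrier R = P" if "primeideal P R" "carrier R \<subseteq> P" for P
    proof -
      interpret primeideal P R by fact
      show ?thesis using a_subset that(2) by blast
    qed
    then have "zero_locus R (carrier R) = {}"
      using primeideal.I_notcarr by (fastforce simp: zero_locus_def Spec_def)
    then show ?thesis by simp
  qed
  then have "openin (zariski R) (Spec R)"
    unfolding openin_zariski by blast
  then show "Spec R \<subseteq> topspace (zariski R)"
    by (rule openin_subset)
qed

text \<open>
  Functions on the spectrum are represented by total functions that are \<^const>\<open>undefined\<close> outside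
  \<open>Spec R\<close> (membership in \<^const>\<open>extensional\<close>), so that equality in \<open>H\<^sub>0\<close> is equality on \<open>Spec R\<close>.
  If \<open>R\<close> is the zero ring, \<open>Spec R\<close> is empty and \<open>H0 R\<close> is the zero ring.
\<close>

definition H0 :: "('a, 'm) ring_scheme \<Rightarrow> ('a set \<Rightarrow> int) ring" where
  "H0 R = \<lparr>
     carrier = {f \<in> extensional (Spec R).
                  continuous_map (zariski R) (discrete_topology UNIV) f},
     monoid.mult = (\<lambda>f g. \<lambda>P \<in> Spec R. f P * g P),
     monoid.one = (\<lambda>P \<in> Spec R. 1),
     ring.zero = (\<lambda>P \<in> Spec R. 0),
     ring.add = (\<lambda>f g. \<lambda>P \<in> Spec R. f P + g P)\<rparr>"

definition Spec_map ::
    "('a, 'm) ring_scheme \<Rightarrow> ('a \<Rightarrow> 'b) \<Rightarrow> 'b set \<Rightarrow> 'a set" where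
  "Spec_map R \<phi> P = {x \<in> carrier R. \<phi> x \<in> P}"

definition H0_map ::
    "('a, 'm) ring_scheme \<Rightarrow> ('b, 'n) ring_scheme \<Rightarrow> ('a \<Rightarrow> 'b) \<Rightarrow>
     ('a set \<Rightarrow> int) \<Rightarrow> 'b set \<Rightarrow> int" where
  "H0_map R R' \<phi> \<psi> = (\<lambda>P \<in> Spec R'. \<psi> (Spec_map R \<phi> P))"

lemma continuous_map_zariski_binop:
  fixes f g :: "'a set \<Rightarrow> int"
  assumes f: "continuous_map (zariski R) (discrete_topology UNIV) f"
    and g: "continuous_map (zariski R) (discrete_topology UNIV) g"
  shows "continuous_map (zariski R) (discrete_topology UNIV) (\<lambda>P \<in> Spec R. h (f P) (g P) :: int)"
  unfolding continuous_map_def topspace_zariski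
proof (intro conjI allI impI)
  fix U :: "int set"
  have "openin (zariski R) {P \<in> Spec R. f P = a}" "openin (zariski R) {P \<in> Spec R. g P = a}" for a
    using openin_continuous_map_preimage[OF f, of "{a}"]
      openin_continuous_map_preimage[OF g, of "{a}"]
    by (simp_all add: topspace_zariski)
  then have "openin (zariski R)
      (\<Union>(a, b) \<in> {(a, b). h a b \<in> U}. {P \<in> Spec R. f P = a} \<inter> {P \<in> Spec R. g P = b})"
    by (intro openin_Union) (auto intro!: openin_Int)
  also have "(\<Union>(a, b) \<in> {(a, b). h a b \<in> U}. {P \<in> Spec R. f P = a} \<inter> {P \<in> Spec R. g P = b})
      = {P \<in> Spec R. (\<lambda>P \<in> Spec R. h (f P) (g P)) P \<in> U}"
    by auto
  finally show "openin (zariski R) {P \<in> Spec R. (\<lambda>P \<in> Spec R. h (f P) (g P)) P \<in> U}" .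
qed auto

lemma continuous_map_zariski_const:
  "continuous_map (zariski R) (discrete_topology UNIV) (\<lambda>P \<in> Spec R. c :: int)"
  by (rule continuous_map_eq[of _ _ "\<lambda>_. c"]) (auto simp: topspace_zariski)

lemma H0_uminus_closed:
  assumes "f \<in> carrier (H0 R)"
  shows "(\<lambda>P \<in> Spec R. - f P) \<in> carrier (H0 R)"
  using assms continuous_map_zariski_binop[of R f f "\<lambda>a b. - a"] by (simp add: H0_def)

lemma H0_cring: "cring (H0 R)"
proof (rule cringI)
  show "abelian_group (H0 R)"
  proof (rule abelian_groupI)
    fix f assume f: "f \<in> carrier (H0 R)"
    show "\<exists>g\<in>carrier (H0 R). g \<oplus>\<^bsub>H0 R\<^esub> f = \<zero>\<^bsub>H0 R\<^esub>"
      by (rule bexI[OF _ H0_uminus_closed[OF f]]) (auto simp: H0_def fun_eq_iff)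
  qed (auto simp: H0_def fun_eq_iff extensional_def restrict_def
       intro: continuous_map_zariski_binop[unfolded restrict_def]
              continuous_map_zariski_const[unfolded restrict_def])
  show "Group.comm_monoid (H0 R)"
    by (rule comm_monoidI)
      (auto simp: H0_def fun_eq_iff extensional_def restrict_def
       intro: continuous_map_zariski_binop[unfolded restrict_def]
              continuous_map_zariski_const[unfolded restrict_def])
qed (auto simp: H0_def fun_eq_iff algebra_simps)

lemma Spec_map_in_Spec:
  assumes "cring R" "cring R'" "\<phi> \<in> ring_hom R R'" "P \<in> Spec R'"
  shows "Spec_map R \<phi> P \<in> Spec R"
proof -
  interpret ring_hom_ring R R' \<phi>
    using assms by (intro ring_hom_ringI2) (auto simp: cring.axioms)
  show ?thesis
    using primeideal_vimage[OF assms(1), of P] assms(4)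
    by (simp add: Spec_def Spec_map_def)
qed

lemma continuous_map_Spec_map:
  assumes "cring R" "cring R'" "\<phi> \<in> ring_hom R R'"
  shows "continuous_map (zariski R') (zariski R) (Spec_map R \<phi>)"
  unfolding continuous_map_def topspace_zariski
proof (intro conjI allI impI)
  show "Spec_map R \<phi> \<in> Spec R' \<rightarrow> Spec R"
    using Spec_map_in_Spec[OF assms] by blast
  fix U assume "openin (zariski R) U"
  then obtain E where E: "E \<subseteq> carrier R" "U = Spec R - zero_locus R E"
    unfolding openin_zariski by blast
  have "{P \<in> Spec R'. Spec_map R \<phi> P \<in> U} = Spec R' - zero_locus R' (\<phi> ` E)"
    unfolding E(2) Spec_Diff_zero_locus using E(1) Spec_map_in_Spec[OF assms]
    by (auto simp: Spec_map_def)
  moreover have "\<phi> ` E \<subseteq> carrier R'"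
    using E(1) ring_hom_closed[OF assms(3)] by blast
  ultimately show "openin (zariski R') {P \<in> Spec R'. Spec_map R \<phi> P \<in> U}"
    unfolding openin_zariski by blast
qed

lemma H0_map_ring_hom:
  assumes "cring R" "cring R'" "\<phi> \<in> ring_hom R R'"
  shows "H0_map R R' \<phi> \<in> ring_hom (H0 R) (H0 R')"
proof (rule ring_hom_memI)
  fix f assume f: "f \<in> carrier (H0 R)"
  have "continuous_map (zariski R') (discrete_topology UNIV) (f \<circ> Spec_map R \<phi>)"
    using f continuous_map_Spec_map[OF assms] by (auto simp: H0_def intro: continuous_map_compose)
  then have "continuous_map (zariski R') (discrete_topology UNIV) (H0_map R R' \<phi> f)"
    by (rule continuous_map_eq) (simp add: topspace_zariski H0_map_def)
  then show "H0_map R R' \<phi> f \<in> carrier (H0 R')"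
    by (simp add: H0_def) (simp add: H0_map_def)
qed (auto simp: H0_def H0_map_def fun_eq_iff Spec_map_in_Spec[OF assms])

end

theory Submission
  imports Defs
begin

text \<open>
  For a commutative ring, \<open>e \<mapsto> D(e) = {P. e \<notin> P}\<close> is a bijection from the idempotents onto the
  clopen subsets of the spectrum, and the preimage of \<open>D(e)\<close> under \<open>\<phi>\<^sup>*\<close> is \<open>D(\<phi> e)\<close>.
  A continuous function on the spectrum takes only finitely many values, so it is a finite
  \<open>\<int>\<close>-linear combination of indicator functions of sets \<open>D(e)\<close>; lifting the idempotents
  lifts the function. Conversely, the level sets of a preimage of the indicator function of \<open>D(e')\<close>
  provide an idempotent over \<open>e'\<close>. For injectivity, the set where two functions differ is some
  \<open>D(e)\<close>, and their images agree iff \<open>\<phi> e = 0\<close>.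
\<close>

subsection \<open>Prime ideals\<close>

text \<open>Zorn's lemma yields an ideal \<open>M\<close> maximal among those that contain
  \<open>I\<close> and miss every power of \<open>s\<close>. It is prime: for \<open>a\<close> and
  \<open>b\<close> outside \<open>M\<close>, both \<open>M + (a)\<close> and \<open>M + (b)\<close>
  contain powers of \<open>s\<close>, hence so does \<open>M + (ab)\<close>, which would be
  \<open>M\<close> itself if \<open>ab\<close> were in \<open>M\<close>.\<close>

lemma (in cring) primeideal_avoiding_powers:
  assumes I: "ideal I R" and s: "s \<in> carrier R" and avoid: "\<And>n::nat. s [^] n \<notin> I"
  obtains P where "primeideal P R" "I \<subseteq> P" "s \<notin> P"
proof -
  define \<A> where "\<A> = {J. ideal J R \<and> I \<subseteq> J \<and> (\<forall>n::nat. s [^] n \<notin> J)}"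
  have "\<exists>M\<in>\<A>. \<forall>J\<in>\<A>. M \<subseteq> J \<longrightarrow> J = M"
  proof (rule subset_Zorn_nonempty)
    show "\<A> \<noteq> {}"
      using I avoid by (auto simp: \<A>_def)
    fix \<C> assume \<C>: "\<C> \<noteq> {}" "subset.chain \<A> \<C>"
    then have sub: "\<C> \<subseteq> \<A>"
      by (simp add: subset_chain_def)
    then have "subset.chain {J. ideal J R} \<C>"
      using \<C>(2) by (auto simp: subset_chain_def \<A>_def)
    then have "ideal (\<Union>\<C>) R"
      using chain_Union_is_ideal[of \<C>] \<C>(1) by simp
    moreover have "I \<subseteq> \<Union>\<C>"
      using \<C>(1) sub unfolding \<A>_def by blast
    ultimately show "\<Union>\<C> \<in> \<A>"
      using sub unfolding \<A>_def by blast
  qed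
  then obtain M where M: "M \<in> \<A>" and maximal: "\<And>J. J \<in> \<A> \<Longrightarrow> M \<subseteq> J \<Longrightarrow> J = M"
    by blast
  interpret M: ideal M R
    using M by (simp add: \<A>_def)
  \<comment> \<open>\<open>M + (a)\<close> is an ideal strictly larger than \<open>M\<close>, so
    maximality forces it to contain a power of \<open>s\<close>.\<close>
  have power_in: "\<exists>m\<in>M. \<exists>r\<in>carrier R. \<exists>n::nat. s [^] n = m \<oplus> r \<otimes> a"
    if a: "a \<in> carrier R" "a \<notin> M" for a
  proof -
    have J: "ideal (M <+>\<^bsub>R\<^esub> PIdl a) R"
      by (intro add_ideals cgenideal_ideal a M.is_ideal)
    have "M \<union> PIdl a \<subseteq> M <+>\<^bsub>R\<^esub> PIdl a"
      using union_genideal[OF M.is_ideal cgenideal_ideal[OF a(1)]]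
        genideal_self[of "M \<union> PIdl a"] M.a_subset
        additive_subgroup.a_subset[OF ideal.axioms(1)[OF cgenideal_ideal[OF a(1)]]]
      by blast
    then have "M \<subseteq> M <+>\<^bsub>R\<^esub> PIdl a" "a \<in> M <+>\<^bsub>R\<^esub> PIdl a"
      using cgenideal_self[OF a(1)] by auto
    then have "M <+>\<^bsub>R\<^esub> PIdl a \<notin> \<A>"
      using maximal a(2) by blast
    then obtain n :: nat where "s [^] n \<in> M <+>\<^bsub>R\<^esub> PIdl a"
      using J \<open>M \<subseteq> M <+>\<^bsub>R\<^esub> PIdl a\<close> M unfolding \<A>_def by blast
    then show ?thesis
      by (auto simp: set_add_def' cgenideal_def)
  qed
  have "primeideal M R"
  proof (rule primeidealI[OF M.is_ideal is_cring])
    show "carrier R \<noteq> M"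
      using M s by (auto simp: \<A>_def)
    fix a b assume a: "a \<in> carrier R" and b: "b \<in> carrier R" and ab: "a \<otimes> b \<in> M"
    show "a \<in> M \<or> b \<in> M"
    proof (rule ccontr)
      assume "\<not> (a \<in> M \<or> b \<in> M)"
      then obtain m r m' r' and k l :: nat
        where m: "m \<in> M" "r \<in> carrier R" "s [^] k = m \<oplus> r \<otimes> a"
          and m': "m' \<in> M" "r' \<in> carrier R" "s [^] l = m' \<oplus> r' \<otimes> b"
        using power_in[OF a] power_in[OF b] by blast
      have "s [^] (k + l) = (m \<oplus> r \<otimes> a) \<otimes> (m' \<oplus> r' \<otimes> b)"
        using nat_pow_mult[OF s, of k l] m(3) m'(3) by simp
      \<comment> \<open>Expanded so that each summand has a factor in \<open>M\<close>:
        \<open>m\<close>, \<open>m'\<close> or \<open>a \<otimes> b\<close>.\<close>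
      also have "\<dots> = m \<otimes> (m' \<oplus> r' \<otimes> b) \<oplus> ((r \<otimes> a) \<otimes> m' \<oplus> (r \<otimes> r') \<otimes> (a \<otimes> b))"
        using m(1,2) m'(1,2) a b M.Icarr by algebra
      also have "\<dots> \<in> M"
        using m(1,2) m'(1,2) a b ab M.Icarr
        by (simp add: M.a_closed M.I_l_closed M.I_r_closed)
      finally show False
        using M by (auto simp: \<A>_def)
    qed
  qed
  moreover have "s \<notin> M"
    using M s nat_pow_eone[OF s] unfolding \<A>_def by (metis (no_types, lifting) mem_Collect_eq)
  ultimately show thesis
    using that M by (auto simp: \<A>_def)
qed

lemma (in cring) exists_primeideal_over:
  assumes "ideal I R" "\<one> \<notin> I"
  obtains P where "primeideal P R" "I \<subseteq> P"
proof -
  have avoid: "\<one> [^] n \<notin> I" for n :: nat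
    using assms(2) by simp
  obtain P where "primeideal P R" "I \<subseteq> P"
    by (rule primeideal_avoiding_powers[OF assms(1) one_closed avoid])
  then show thesis
    by (rule that)
qed

text \<open>If no power of \<open>x\<close> vanishes, the zero ideal misses them all, and
  \<open>primeideal_avoiding_powers\<close> gives a prime ideal without \<open>x\<close>.\<close>

lemma (in cring) nilpotent_if_in_all_primeideals:
  assumes "x \<in> carrier R" "\<And>P. primeideal P R \<Longrightarrow> x \<in> P"
  obtains n :: nat where "x [^] n = \<zero>"
proof -
  have "\<exists>n::nat. x [^] n = \<zero>"
  proof (rule ccontr)
    assume "\<nexists>n::nat. x [^] n = \<zero>"
    then have "x [^] n \<notin> {\<zero>}" for n :: nat
      by simp
    then obtain P where "primeideal P R" "x \<notin> P"
      using primeideal_avoiding_powers[OF zeroideal assms(1)] by metis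
    then show False
      using assms(2) by blast
  qed
  then show thesis
    using that by blast
qed

lemma (in primeideal) in_if_nat_pow_in:
  assumes "x \<in> carrier R" "x [^] (n::nat) \<in> I"
  shows "x \<in> I"
  using assms(2)
proof (induction n)
  case 0
  \<comment> \<open>The zeroth power is one, which a proper ideal cannot contain, so this case is
    vacuous.\<close>
  then show ?case
    using one_imp_carrier I_notcarr by simp
next
  case (Suc n)
  then show ?case
    using I_prime[of "x [^] n" x] assms(1) by auto
qed

lemma (in primeideal) one_notin: "\<one> \<notin> I"
  using one_imp_carrier I_notcarr by metis

subsection \<open>Idempotents and clopen sets\<close>

definition basic_open :: "('a, 'm) ring_scheme \<Rightarrow> 'a \<Rightarrow> 'a set set" where
  "basic_open R x = {P \<in> Spec R. x \<notin> P}"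

lemma openin_basic_open:
  "x \<in> carrier R \<Longrightarrow> openin (zariski R) (basic_open R x)"
  unfolding openin_zariski Spec_Diff_zero_locus basic_open_def
proof (intro exI conjI)
  assume "x \<in> carrier R"
  then show "{x} \<subseteq> carrier R" by simp
qed simp

lemma basic_open_neighbourhood:
  assumes "openin (zariski R) U" "P \<in> U"
  obtains x where "x \<in> carrier R" "P \<in> basic_open R x" "basic_open R x \<subseteq> U"
proof -
  obtain E where E: "E \<subseteq> carrier R" "U = {Q \<in> Spec R. \<not> E \<subseteq> Q}"
    using assms(1) unfolding openin_zariski Spec_Diff_zero_locus by blast
  then obtain x where "x \<in> E" "x \<notin> P" "P \<in> Spec R"
    using assms(2) by blast
  with E show thesis
    by (intro that[of x]) (auto simp: basic_open_def)
qed

lemma basic_open_preimage: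
  assumes "cring R" "cring R'" "\<phi> \<in> ring_hom R R'" "x \<in> carrier R" "P \<in> Spec R'"
  shows "Spec_map R \<phi> P \<in> basic_open R x \<longleftrightarrow> P \<in> basic_open R' (\<phi> x)"
proof -
  have "x \<in> Spec_map R \<phi> P \<longleftrightarrow> \<phi> x \<in> P"
    using assms(4) by (simp add: Spec_map_def)
  then show ?thesis
    using Spec_map_in_Spec[OF assms(1-3,5)] assms(5) by (simp add: basic_open_def)
qed

context cring
begin

lemma basic_open_zero: "basic_open R \<zero> = {}"
proof -
  have "\<zero> \<in> P" if "primeideal P R" for P
  proof -
    interpret primeideal P R by fact
    show ?thesis by simp
  qed
  then show ?thesis
    by (auto simp: basic_open_def Spec_def)
qed

lemma basic_open_one: "basic_open R \<one> = Spec R"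
proof -
  have "\<one> \<notin> P" if "primeideal P R" for P
    using that by (rule primeideal.one_notin)
  then show ?thesis
    by (auto simp: basic_open_def Spec_def)
qed

lemma basic_open_add: "basic_open R (x \<oplus> y) \<subseteq> basic_open R x \<union> basic_open R y"
proof -
  have "x \<oplus> y \<in> P" if "primeideal P R" "x \<in> P" "y \<in> P" for P
  proof -
    interpret primeideal P R by fact
    show ?thesis using that by simp
  qed
  then show ?thesis
    by (auto simp: basic_open_def Spec_def)
qed

lemma basic_open_mult:
  assumes "x \<in> carrier R" "y \<in> carrier R"
  shows "basic_open R (x \<otimes> y) = basic_open R x \<inter> basic_open R y"
proof -
  have "x \<otimes> y \<in> P \<longleftrightarrow> x \<in> P \<or> y \<in> P" if "primeideal P R" for P
  proof -
    interpret primeideal P R by fact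
    show ?thesis using I_prime I_l_closed I_r_closed assms by blast
  qed
  then show ?thesis
    by (auto simp: basic_open_def Spec_def)
qed

lemma basic_open_minus:
  assumes "x \<in> carrier R"
  shows "basic_open R (\<ominus> x) \<subseteq> basic_open R x"
proof -
  have "\<ominus> x \<in> P" if "primeideal P R" "x \<in> P" for P
  proof -
    interpret primeideal P R by fact
    show ?thesis using that by simp
  qed
  then show ?thesis
    by (auto simp: basic_open_def Spec_def)
qed

text \<open>Closure of \<open>\<Q>\<close> under unions and subsets suffices because D(x + y) lies
  in the union of D(x) and D(y), and D(xy) lies in D(x). The instances used are the subsets of a
  clopen set, those of its complement, and the sets on which a function has finite range.\<close>

lemma ideal_of_small_basic_opens:
  assumes "{} \<in> \<Q>" "\<And>S T. S \<in> \<Q> \<Longrightarrow> T \<in> \<Q> \<Longrightarrow> S \<union> T \<in> \<Q>" "\<And>S T. S \<in> \<Q> \<Longrightarrow> T \<subseteq> S \<Longrightarrow> T \<in> \<Q>"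
  shows "ideal {x \<in> carrier R. basic_open R x \<in> \<Q>} R"
proof (rule idealI[OF ring_axioms])
  show "subgroup {x \<in> carrier R. basic_open R x \<in> \<Q>} (add_monoid R)"
  proof (rule add.subgroupI)
    show "{x \<in> carrier R. basic_open R x \<in> \<Q>} \<noteq> {}"
      using assms(1) basic_open_zero by auto
    fix x assume "x \<in> {x \<in> carrier R. basic_open R x \<in> \<Q>}"
    then show "\<ominus> x \<in> {x \<in> carrier R. basic_open R x \<in> \<Q>}"
      using assms(3)[OF _ basic_open_minus] by simp
  next
    fix x y
    assume "x \<in> {x \<in> carrier R. basic_open R x \<in> \<Q>}" "y \<in> {x \<in> carrier R. basic_open R x \<in> \<Q>}"
    then show "x \<oplus> y \<in> {x \<in> carrier R. basic_open R x \<in> \<Q>}"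
      using assms(3)[OF assms(2) basic_open_add] by simp
  qed auto
next
  fix a x assume "a \<in> {x \<in> carrier R. basic_open R x \<in> \<Q>}" "x \<in> carrier R"
  then show "x \<otimes> a \<in> {x \<in> carrier R. basic_open R x \<in> \<Q>}"
    "a \<otimes> x \<in> {x \<in> carrier R. basic_open R x \<in> \<Q>}"
    using assms(3)[of "basic_open R a"] by (simp_all add: basic_open_mult)
qed

text \<open>This takes the place of quasi-compactness of the spectrum: a proper ideal lies in some
  prime \<open>P\<close>, and then no D(x) with \<open>x \<in> I\<close> contains
  \<open>P\<close>.\<close>

lemma one_in_ideal_if_basic_opens_cover:
  assumes "ideal I R" "\<And>P. P \<in> Spec R \<Longrightarrow> \<exists>x\<in>I. P \<in> basic_open R x"
  shows "\<one> \<in> I"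
proof (rule ccontr)
  assume "\<one> \<notin> I"
  then obtain P where "primeideal P R" "I \<subseteq> P"
    using exists_primeideal_over[OF assms(1)] by metis
  then show False
    using assms(2)[of P] by (auto simp: basic_open_def Spec_def)
qed

text \<open>The splitting of the spectrum gives \<open>\<one> = a \<oplus> b\<close> with D(a)
  inside \<open>C\<close> and D(b) inside its complement, so ab is nilpotent. Suitable powers of
  \<open>a\<close> and \<open>b\<close> have product zero and still generate the unit ideal; the two
  terms of the resulting expression for one are complementary orthogonal idempotents.\<close>

lemma clopen_eq_basic_open_idempotent:
  assumes C: "openin (zariski R) C" and D: "openin (zariski R) (Spec R - C)"
  obtains e where "e \<in> idempotents R" "basic_open R e = C"
proof -
  have CS: "C \<subseteq> Spec R"
    using openin_subset[OF C] by (simp add: topspace_zariski)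
  define A where "A = {x \<in> carrier R. basic_open R x \<in> Pow C}"
  define B where "B = {x \<in> carrier R. basic_open R x \<in> Pow (Spec R - C)}"
  have A: "ideal A R" and B: "ideal B R"
    unfolding A_def B_def by (rule ideal_of_small_basic_opens; blast)+
  have "\<one> \<in> A <+>\<^bsub>R\<^esub> B"
  proof (rule one_in_ideal_if_basic_opens_cover[OF add_ideals[OF A B]])
    fix P assume P: "P \<in> Spec R"
    have "A \<union> B \<subseteq> A <+>\<^bsub>R\<^esub> B"
      using union_genideal[OF A B] genideal_self[of "A \<union> B"] by (auto simp: A_def B_def)
    moreover have "\<exists>x\<in>A \<union> B. P \<in> basic_open R x"
    proof (cases "P \<in> C")
      case True
      then show ?thesis
        using basic_open_neighbourhood[OF C] unfolding A_def by blast
    next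
      case False
      then have "P \<in> Spec R - C"
        using P by blast
      then show ?thesis
        using basic_open_neighbourhood[OF D] unfolding B_def by blast
    qed
    ultimately show "\<exists>x\<in>A <+>\<^bsub>R\<^esub> B. P \<in> basic_open R x"
      by blast
  qed
  then obtain a b where a: "a \<in> carrier R" "basic_open R a \<subseteq> C"
    and b: "b \<in> carrier R" "basic_open R b \<subseteq> Spec R - C" and ab: "\<one> = a \<oplus> b"
    by (auto simp: set_add_def' A_def B_def)
  have "basic_open R (a \<otimes> b) = {}"
    using basic_open_mult[OF a(1) b(1)] a(2) b(2) by auto
  then obtain m :: nat where "(a \<otimes> b) [^] m = \<zero>"
    using nilpotent_if_in_all_primeideals[of "a \<otimes> b"] a(1) b(1)
    by (auto simp: basic_open_def Spec_def)
  \<comment> \<open>A positive exponent keeps D(a^n) inside D(a); with exponent zero the power would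
    be one, whose open set is everything.\<close>
  moreover define n where "n = Suc m"
  ultimately have n: "(a \<otimes> b) [^] n = \<zero>"
    using a(1) b(1) by simp
  let ?a = "a [^] n" and ?b = "b [^] n"
  have an: "?a \<in> carrier R" and bn: "?b \<in> carrier R"
    using a b by auto
  have abn: "?a \<otimes> ?b = \<zero>"
    using n nat_pow_distrib[OF a(1) b(1)] by simp
  \<comment> \<open>Powers of comaximal elements are comaximal, because a prime containing both powers contains
      both elements.\<close>
  let ?K = "PIdl ?a <+>\<^bsub>R\<^esub> PIdl ?b"
  have K: "ideal ?K R"
    by (intro add_ideals cgenideal_ideal an bn)
  have "\<one> \<in> ?K"
  proof (rule ccontr)
    assume "\<one> \<notin> ?K"
    then obtain P where P: "primeideal P R" "?K \<subseteq> P"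
      using exists_primeideal_over[OF K] by blast
    interpret P: primeideal P R
      by (fact P(1))
    have "?a = \<one> \<otimes> ?a \<oplus> \<zero> \<otimes> ?b" "?b = \<zero> \<otimes> ?a \<oplus> \<one> \<otimes> ?b"
      using an bn by auto
    then have "?a \<in> ?K" "?b \<in> ?K"
      unfolding set_add_def' cgenideal_def by blast+
    then have "a \<in> P" "b \<in> P"
      using P(2) P.in_if_nat_pow_in a(1) b(1) by blast+
    then have "\<one> \<in> P"
      using ab P.a_closed by simp
    then show False
      using P.one_notin by contradiction
  qed
  then obtain x y where x: "x \<in> carrier R" and y: "y \<in> carrier R"
    and xy: "\<one> = x \<otimes> ?a \<oplus> y \<otimes> ?b"
    by (auto simp: set_add_def' cgenideal_def)
  define e where "e = x \<otimes> ?a"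
  define f where "f = y \<otimes> ?b"
  have ef: "e \<in> carrier R" "f \<in> carrier R" "\<one> = e \<oplus> f"
    using x y an bn xy by (auto simp: e_def f_def)
  have "e \<otimes> f = (x \<otimes> y) \<otimes> (?a \<otimes> ?b)"
    using x y an bn unfolding e_def f_def by algebra
  then have "e \<otimes> f = \<zero>"
    using abn x y by simp
  \<comment> \<open>Multiplying \<open>\<one> = e \<oplus> f\<close> by \<open>e\<close> turns
    orthogonality into idempotence.\<close>
  then have "e \<otimes> e = e \<otimes> (e \<oplus> f)"
    using ef(1,2) by (simp add: r_distr)
  also have "\<dots> = e"
    using ef(1) ef(3)[symmetric] by simp
  finally have "e \<in> idempotents R"
    using ef(1) by (simp add: idempotents_def)
  moreover have "basic_open R e = C"
  proof
    have pow: "basic_open R (z [^] n) \<subseteq> basic_open R z" if "z \<in> carrier R" for z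
      using that basic_open_mult[of "z [^] m" z] by (simp add: n_def)
    show "basic_open R e \<subseteq> C"
      using pow[OF a(1)] a(2) basic_open_mult[OF x an] unfolding e_def by blast
    \<comment> \<open>D(e) and D(f) cover the spectrum since e + f is one, and D(f) lies in D(b),
      which misses \<open>C\<close>.\<close>
    show "C \<subseteq> basic_open R e"
    proof
      fix P assume P: "P \<in> C"
      then have "P \<in> basic_open R \<one>"
        using CS by (auto simp: basic_open_one)
      then have "P \<in> basic_open R e \<or> P \<in> basic_open R f"
        using basic_open_add[of e f] ef(3) by auto
      moreover have "P \<notin> basic_open R f"
        using pow[OF b(1)] b(2) basic_open_mult[OF y bn] P unfolding f_def by blast
      ultimately show "P \<in> basic_open R e"
        by blast
    qed
  qed
  ultimately show thesis
    by (rule that)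
qed

section \<open>Complements and order of idempotents\<close>

lemma idempotent_complement:
  assumes "e \<in> idempotents R"
  shows "\<one> \<ominus> e \<in> carrier R" "e \<otimes> (\<one> \<ominus> e) = \<zero>"
proof -
  have e: "e \<in> carrier R" "e \<otimes> e = e"
    using assms by (auto simp: idempotents_def)
  then show "\<one> \<ominus> e \<in> carrier R"
    by simp
  have "e \<otimes> (\<one> \<ominus> e) = e \<ominus> e \<otimes> e"
    using e(1) by algebra
  then show "e \<otimes> (\<one> \<ominus> e) = \<zero>"
    using e by (simp add: a_minus_def r_neg)
qed

text \<open>The two open sets are disjoint because e(1 - e) is zero, and they cover because e + (1 -
  e) is one.\<close>

lemma basic_open_complement:
  assumes "e \<in> idempotents R"
  shows "basic_open R (\<one> \<ominus> e) = Spec R - basic_open R e"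
proof -
  have e: "e \<in> carrier R"
    using assms by (simp add: idempotents_def)
  have "basic_open R e \<inter> basic_open R (\<one> \<ominus> e) = {}"
    using basic_open_mult[OF e idempotent_complement(1)[OF assms]] basic_open_zero
    by (simp add: idempotent_complement(2)[OF assms])
  moreover have "e \<oplus> (\<one> \<ominus> e) = \<one>"
    using e by algebra
  then have "Spec R \<subseteq> basic_open R e \<union> basic_open R (\<one> \<ominus> e)"
    using basic_open_add[of e "\<one> \<ominus> e"] by (simp add: basic_open_one)
  moreover have "basic_open R (\<one> \<ominus> e) \<subseteq> Spec R"
    by (auto simp: basic_open_def)
  ultimately show ?thesis
    by blast
qed

lemma idempotent_nat_pow:
  assumes "e \<in> idempotents R"
  shows "e [^] Suc n = e"
proof -
  have e: "e \<in> carrier R" "e \<otimes> e = e"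
    using assms by (auto simp: idempotents_def)
  show ?thesis
    by (induction n) (simp_all add: e)
qed

text \<open>An element of every prime is nilpotent, while an idempotent equals each of its positive
  powers.\<close>

lemma idempotent_eq_zero_if_basic_open_empty:
  assumes "e \<in> idempotents R" "basic_open R e = {}"
  shows "e = \<zero>"
proof -
  have e: "e \<in> carrier R"
    using assms(1) by (simp add: idempotents_def)
  moreover have "e \<in> P" if "primeideal P R" for P
    using that assms(2) by (auto simp: basic_open_def Spec_def)
  ultimately obtain n :: nat where "e [^] n = \<zero>"
    by (rule nilpotent_if_in_all_primeideals)
  \<comment> \<open>The exponent obtained may be zero, so one more factor is needed before
    \<open>idempotent_nat_pow\<close> applies.\<close>
  then have "e [^] Suc n = \<zero>"
    using e by simp
  then show ?thesis
    using idempotent_nat_pow[OF assms(1), of n] by (simp only:)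
qed

lemma idempotents_mult:
  assumes "e \<in> idempotents R" "f \<in> idempotents R"
  shows "e \<otimes> f \<in> idempotents R"
proof -
  have "e \<in> carrier R" "f \<in> carrier R" "e \<otimes> e = e" "f \<otimes> f = f"
    using assms by (auto simp: idempotents_def)
  moreover from this(1,2) have "(e \<otimes> f) \<otimes> (e \<otimes> f) = (e \<otimes> e) \<otimes> (f \<otimes> f)"
    by algebra
  ultimately show ?thesis
    by (simp add: idempotents_def)
qed

lemma idempotent_complement_idempotent:
  assumes "e \<in> idempotents R"
  shows "\<one> \<ominus> e \<in> idempotents R"
proof -
  note f = idempotent_complement[OF assms]
  have "e \<in> carrier R"
    using assms by (simp add: idempotents_def)
  then have "(\<one> \<ominus> e) \<otimes> (\<one> \<ominus> e) = (\<one> \<ominus> e) \<ominus> e \<otimes> (\<one> \<ominus> e)"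
    by algebra
  then show ?thesis
    using f by (simp add: idempotents_def a_minus_def)
qed

text \<open>The idempotent e(1 - f) has empty open set, hence vanishes. Inclusion of clopen sets
  thus becomes the usual order on idempotents.\<close>

lemma idempotent_le_if_basic_open_subset:
  assumes "e \<in> idempotents R" "f \<in> idempotents R" "basic_open R e \<subseteq> basic_open R f"
  shows "e \<otimes> f = e"
proof -
  have e: "e \<in> carrier R" and f: "f \<in> carrier R"
    using assms by (auto simp: idempotents_def)
  have "basic_open R (e \<otimes> (\<one> \<ominus> f)) = {}"
    using basic_open_mult[OF e idempotent_complement(1)[OF assms(2)]]
      basic_open_complement[OF assms(2)] assms(3) by auto
  then have "e \<otimes> (\<one> \<ominus> f) = \<zero>"
    by (intro idempotent_eq_zero_if_basic_open_empty idempotents_mult assms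
        idempotent_complement_idempotent)
  moreover have "e \<otimes> f \<oplus> e \<otimes> (\<one> \<ominus> f) = e"
    using e f by algebra
  ultimately show ?thesis
    using e f by simp
qed

text \<open>This recovers an idempotent from its clopen set; it is what identifies
  \<open>\<phi> e\<close> with \<open>e'\<close> in \<open>lifts_if_H0_map_surj\<close>.\<close>

lemma basic_open_inj_on_idempotents: "inj_on (basic_open R) (idempotents R)"
proof (rule inj_onI)
  fix e f assume ef: "e \<in> idempotents R" "f \<in> idempotents R" "basic_open R e = basic_open R f"
  then have "e = e \<otimes> f"
    using idempotent_le_if_basic_open_subset[of e f] by simp
  also have "\<dots> = f \<otimes> e"
    using ef by (intro m_comm) (auto simp: idempotents_def)
  also have "\<dots> = f"
    using ef idempotent_le_if_basic_open_subset[of f e] by simp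
  finally show "e = f" .
qed

subsection \<open>Continuous integer-valued functions on the spectrum\<close>

text \<open>D(e) and its complement D(1 - e) are both open, and every preimage is a union of some of
  these two sets.\<close>

lemma indicator_in_H0:
  assumes "e \<in> idempotents R"
  shows "(\<lambda>P\<in>Spec R. if P \<in> basic_open R e then k else 0) \<in> carrier (H0 R)"
proof -
  let ?f = "\<lambda>P\<in>Spec R. if P \<in> basic_open R e then k else 0"
  have e: "openin (zariski R) (basic_open R e)" "openin (zariski R) (Spec R - basic_open R e)"
    using openin_basic_open[of e R] openin_basic_open[of "\<one> \<ominus> e" R]
      basic_open_complement[OF assms] idempotent_complement(1)[OF assms] assms
    by (auto simp: idempotents_def)
  have "openin (zariski R) {P \<in> Spec R. ?f P \<in> U}" for U
  proof -
    have "{P \<in> Spec R. ?f P \<in> U} =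
        (if k \<in> U then basic_open R e else {}) \<union> (if 0 \<in> U then Spec R - basic_open R e else {})"
      by (auto simp: basic_open_def)
    then show ?thesis
      using openin_Un[OF e] e openin_topspace[of "zariski R"]
      by (auto simp: topspace_zariski basic_open_def Un_absorb1)
  qed
  then show ?thesis
    by (auto simp: H0_def continuous_map_def topspace_zariski simp del: restrict_apply)
qed

lemma H0_binop:
  fixes h :: "int \<Rightarrow> int \<Rightarrow> int"
  assumes "f \<in> carrier (H0 R)" "g \<in> carrier (H0 R)"
  shows "(\<lambda>P\<in>Spec R. h (f P) (g P)) \<in> carrier (H0 R)"
proof -
  have "continuous_map (zariski R) (discrete_topology UNIV) (\<lambda>P\<in>Spec R. h (f P) (g P))"
    using assms by (intro continuous_map_zariski_binop) (simp_all add: H0_def)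
  then show ?thesis
    by (simp add: H0_def)
qed

lemma H0_sum:
  assumes "finite N" "\<And>n. n \<in> N \<Longrightarrow> f n \<in> carrier (H0 R)"
  shows "(\<lambda>P\<in>Spec R. \<Sum>n\<in>N. f n P) \<in> carrier (H0 R)"
  using assms
proof (induction N)
  case empty
  have "\<zero>\<^bsub>H0 R\<^esub> \<in> carrier (H0 R)"
    using H0_cring by (rule cring.cring_simprules)
  also have "\<zero>\<^bsub>H0 R\<^esub> = (\<lambda>P\<in>Spec R. \<Sum>n\<in>{}. f n P)"
    by (simp add: H0_def)
  finally show ?case .
next
  case (insert n N)
  have "(\<lambda>P\<in>Spec R. f n P + (\<lambda>P\<in>Spec R. \<Sum>n\<in>N. f n P) P) \<in> carrier (H0 R)"
    using insert.IH insert.prems by (intro H0_binop[where h = "(+)"]) blast+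
  also have "(\<lambda>P\<in>Spec R. f n P + (\<lambda>P\<in>Spec R. \<Sum>n\<in>N. f n P) P)
      = (\<lambda>P\<in>Spec R. \<Sum>n\<in>insert n N. f n P)"
    using insert by (intro restrict_ext) simp
  finally show ?case .
qed

lemma H0_level_open:
  assumes "g \<in> carrier (H0 R)"
  shows "openin (zariski R) {P \<in> Spec R. g P \<in> U}"
proof -
  have "continuous_map (zariski R) (discrete_topology UNIV) g"
    using assms by (simp add: H0_def)
  from openin_continuous_map_preimage[OF this, of U] show ?thesis
    by (simp add: topspace_zariski)
qed

text \<open>Every set of integers is clopen in the discrete topology, so its preimage is clopen.
  Arbitrary \<open>U\<close> serves both single values and the set of nonzero integers.\<close>

lemma H0_level_idempotent:
  assumes "g \<in> carrier (H0 R)"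
  obtains e where "e \<in> idempotents R" "basic_open R e = {P \<in> Spec R. g P \<in> U}"
proof (rule clopen_eq_basic_open_idempotent)
  show "openin (zariski R) {P \<in> Spec R. g P \<in> U}"
    by (rule H0_level_open[OF assms])
  have "Spec R - {P \<in> Spec R. g P \<in> U} = {P \<in> Spec R. g P \<in> - U}"
    by auto
  then show "openin (zariski R) (Spec R - {P \<in> Spec R. g P \<in> U})"
    using H0_level_open[OF assms, of "- U"] by simp
qed

text \<open>The elements \<open>x\<close> such that \<open>g\<close> takes finitely many values on \<open>D(x)\<close> form an ideal, which no
  prime \<open>P\<close> contains because \<open>g\<close> is constant near \<open>P\<close>.\<close>

lemma H0_finite_range:
  assumes g: "g \<in> carrier (H0 R)"
  shows "finite (g ` Spec R)"
proof -
  let ?I = "{x \<in> carrier R. basic_open R x \<in> {S. finite (g ` S)}}"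
  have I: "ideal ?I R"
    by (rule ideal_of_small_basic_opens)
      (simp_all add: image_Un, metis finite_subset image_mono)
  have "\<one> \<in> ?I"
  proof (rule one_in_ideal_if_basic_opens_cover[OF I])
    fix P assume "P \<in> Spec R"
    then obtain x where x: "x \<in> carrier R" "P \<in> basic_open R x"
      "basic_open R x \<subseteq> {Q \<in> Spec R. g Q \<in> {g P}}"
      using basic_open_neighbourhood[OF H0_level_open[OF g, of "{g P}"], of P] by blast
    have "g ` basic_open R x \<subseteq> {g P}"
      using x(3) by blast
    then have "finite (g ` basic_open R x)"
      by (rule finite_subset) simp
    then show "\<exists>x\<in>?I. P \<in> basic_open R x"
      using x by blast
  qed
  then show ?thesis
    by (simp add: basic_open_one)
qed

lemma H0_eqI:
  assumes "f \<in> carrier (H0 R)" "g \<in> carrier (H0 R)" "\<And>P. P \<in> Spec R \<Longrightarrow> f P = g P"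
  shows "f = g"
proof (rule extensionalityI)
  show "f \<in> extensional (Spec R)" "g \<in> extensional (Spec R)"
    using assms(1,2) by (simp_all add: H0_def)
qed (fact assms(3))

end

subsection \<open>Functoriality\<close>

context
  fixes R :: "('a, 'm) ring_scheme" and R' :: "('b, 'n) ring_scheme" and \<phi> :: "'a \<Rightarrow> 'b"
  assumes R: "cring R" and R': "cring R'" and \<phi>: "\<phi> \<in> ring_hom R R'"
begin

interpretation R: cring R by (rule R)
interpretation R': cring R' by (rule R')
interpretation ring_hom_cring R R' \<phi>
  using \<phi> by unfold_locales

lemma hom_idempotent:
  assumes "e \<in> idempotents R"
  shows "\<phi> e \<in> idempotents R'"
proof -
  have e: "e \<in> carrier R" "e \<otimes>\<^bsub>R\<^esub> e = e"
    using assms by (auto simp: idempotents_def)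
  have "\<phi> e \<otimes>\<^bsub>R'\<^esub> \<phi> e = \<phi> (e \<otimes>\<^bsub>R\<^esub> e)"
    by (rule hom_mult[OF e(1) e(1), symmetric])
  then show ?thesis
    unfolding e(2) using e(1) by (simp add: idempotents_def)
qed

lemma H0_map_closed: "f \<in> carrier (H0 R) \<Longrightarrow> H0_map R R' \<phi> f \<in> carrier (H0 R')"
  by (rule ring_hom_closed[OF H0_map_ring_hom[OF R R' \<phi>]])

section \<open>Surjectivity and lifting of idempotents\<close>

lemma H0_map_surj_if_lifts:
  assumes lifts: "lifts_idempotents R R' \<phi>" and g: "g \<in> carrier (H0 R')"
  shows "g \<in> H0_map R R' \<phi> ` carrier (H0 R)"
proof -
  have "\<exists>f \<in> idempotents R. basic_open R' (\<phi> f) = {P \<in> Spec R'. g P \<in> {n}}" for n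
  proof -
    obtain e' where "e' \<in> idempotents R'" "basic_open R' e' = {P \<in> Spec R'. g P \<in> {n}}"
      by (rule R'.H0_level_idempotent[OF g])
    with lifts show ?thesis
      unfolding lifts_idempotents_def by metis
  qed
  then obtain f where f: "\<And>n. f n \<in> idempotents R"
    "\<And>n. basic_open R' (\<phi> (f n)) = {P \<in> Spec R'. g P \<in> {n}}"
    by metis
  let ?N = "g ` Spec R'"
  \<comment> \<open>The lifts \<open>f n\<close> need not be orthogonal, so the sets D(f n) may
    overlap in \<open>Spec R\<close>; their preimages in \<open>Spec R'\<close>, the level sets of
    \<open>g\<close>, are disjoint.\<close>
  define \<psi> where "\<psi> = (\<lambda>P\<in>Spec R. \<Sum>n\<in>?N. (\<lambda>P\<in>Spec R. if P \<in> basic_open R (f n) then n else 0) P)"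
  have \<psi>: "\<psi> \<in> carrier (H0 R)"
    unfolding \<psi>_def by (intro R.H0_sum R.indicator_in_H0 R'.H0_finite_range g f)
  have "H0_map R R' \<phi> \<psi> = g"
  proof (rule R'.H0_eqI[OF H0_map_closed[OF \<psi>] g])
    fix P assume P: "P \<in> Spec R'"
    note Q = Spec_map_in_Spec[OF R R' \<phi> P]
    have fc: "f n \<in> carrier R" for n
      using f(1) by (simp add: idempotents_def)
    have "H0_map R R' \<phi> \<psi> P = (\<Sum>n\<in>?N. if Spec_map R \<phi> P \<in> basic_open R (f n) then n else 0)"
      using P Q by (simp add: H0_map_def \<psi>_def)
    \<comment> \<open>The preimage of D(f n) is the level set of \<open>g\<close> at
      \<open>n\<close>, so only the term for the value \<open>g P\<close> survives.\<close>
    also have "\<dots> = (\<Sum>n\<in>?N. if g P = n then n else 0)"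
      using P by (simp add: basic_open_preimage[OF R R' \<phi> fc P] f(2))
    \<comment> \<open>Finiteness of the range matters: a sum over an infinite index set would be
      zero by convention.\<close>
    also have "\<dots> = g P"
      using P R'.H0_finite_range[OF g] by simp
    finally show "H0_map R R' \<phi> \<psi> P = g P" .
  qed
  then show ?thesis
    using \<psi> by blast
qed

lemma lifts_if_H0_map_surj:
  assumes surj: "carrier (H0 R') \<subseteq> H0_map R R' \<phi> ` carrier (H0 R)"
  shows "lifts_idempotents R R' \<phi>"
  unfolding lifts_idempotents_def
proof
  fix e' assume e': "e' \<in> idempotents R'"
  have "(\<lambda>P\<in>Spec R'. if P \<in> basic_open R' e' then 1 else 0) \<in> H0_map R R' \<phi> ` carrier (H0 R)"
    by (rule subsetD[OF surj R'.indicator_in_H0[OF e']])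
  then obtain \<psi> where \<psi>: "\<psi> \<in> carrier (H0 R)"
    "H0_map R R' \<phi> \<psi> = (\<lambda>P\<in>Spec R'. if P \<in> basic_open R' e' then 1 else 0)"
    by (metis (no_types, lifting) imageE)
  \<comment> \<open>Off the image of \<open>Spec_map R \<phi>\<close> nothing is known about the
    values of \<open>\<psi>\<close>, but its level set at 1 is clopen all the same.\<close>
  obtain e where e: "e \<in> idempotents R" "basic_open R e = {P \<in> Spec R. \<psi> P \<in> {1}}"
    by (rule R.H0_level_idempotent[OF \<psi>(1)])
  have ec: "e \<in> carrier R"
    using e(1) by (simp add: idempotents_def)
  have "P \<in> basic_open R' (\<phi> e) \<longleftrightarrow> P \<in> basic_open R' e'" if P: "P \<in> Spec R'" for P
  proof -
    have "P \<in> basic_open R' (\<phi> e) \<longleftrightarrow> \<psi> (Spec_map R \<phi> P) = 1"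
      using basic_open_preimage[OF R R' \<phi> ec P] e(2) Spec_map_in_Spec[OF R R' \<phi> P] by simp
    also have "\<dots> \<longleftrightarrow> P \<in> basic_open R' e'"
      using fun_cong[OF \<psi>(2), of P] P by (simp add: H0_map_def split: if_splits)
    finally show ?thesis .
  qed
  then have "basic_open R' (\<phi> e) = basic_open R' e'"
    by (auto simp: basic_open_def)
  then have "\<phi> e = e'"
    using R'.basic_open_inj_on_idempotents hom_idempotent[OF e(1)] e' by (auto dest: inj_onD)
  then show "\<exists>e\<in>idempotents R. \<phi> e = e'"
    using e(1) by blast
qed

section \<open>Injectivity and idempotents in the kernel\<close>

lemma kernel_idempotent_eq_zero:
  assumes inj: "inj_on (H0_map R R' \<phi>) (carrier (H0 R))"
    and e: "e \<in> idempotents R" "\<phi> e = \<zero>\<^bsub>R'\<^esub>"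
  shows "e = \<zero>\<^bsub>R\<^esub>"
proof -
  have ec: "e \<in> carrier R" and z: "\<zero>\<^bsub>R\<^esub> \<in> idempotents R"
    using e by (auto simp: idempotents_def)
  \<comment> \<open>The zero function is written as the indicator of D(0), so that
    \<open>indicator_in_H0\<close> covers both functions compared. Both pull back to zero, as
    \<open>\<phi>\<close> sends \<open>e\<close> and zero to zero.\<close>
  let ?\<chi> = "\<lambda>e. \<lambda>P\<in>Spec R. if P \<in> basic_open R e then 1 else 0 :: int"
  have "H0_map R R' \<phi> (?\<chi> e) = H0_map R R' \<phi> (?\<chi> \<zero>\<^bsub>R\<^esub>)"
    using basic_open_preimage[OF R R' \<phi> ec] e(2)
    by (auto simp: H0_map_def fun_eq_iff R.basic_open_zero R'.basic_open_zero
        Spec_map_in_Spec[OF R R' \<phi>])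
  then have eq: "?\<chi> e = ?\<chi> \<zero>\<^bsub>R\<^esub>"
    by (rule inj_onD[OF inj]) (intro R.indicator_in_H0 e z)+
  have "P \<notin> basic_open R e" if "P \<in> Spec R" for P
  proof
    assume "P \<in> basic_open R e"
    then show False
      using fun_cong[OF eq, of P] that by (simp add: R.basic_open_zero)
  qed
  then have "basic_open R e = {}"
    by (auto simp: basic_open_def)
  then show ?thesis
    by (rule R.idempotent_eq_zero_if_basic_open_empty[OF e(1)])
qed

lemma H0_map_inj_if_kernel_idempotents_zero:
  assumes ker: "\<And>e. e \<in> idempotents R \<Longrightarrow> \<phi> e = \<zero>\<^bsub>R'\<^esub> \<Longrightarrow> e = \<zero>\<^bsub>R\<^esub>"
  shows "inj_on (H0_map R R' \<phi>) (carrier (H0 R))"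
proof (rule inj_onI)
  fix f g assume f: "f \<in> carrier (H0 R)" and g: "g \<in> carrier (H0 R)"
    and eq: "H0_map R R' \<phi> f = H0_map R R' \<phi> g"
  \<comment> \<open>Taking the difference turns the set where \<open>f\<close> and \<open>g\<close>
    disagree into a level set, hence into some D(e).\<close>
  have "(\<lambda>P\<in>Spec R. f P - g P) \<in> carrier (H0 R)"
    by (rule R.H0_binop[OF f g])
  then obtain e where e: "e \<in> idempotents R"
    "basic_open R e = {P \<in> Spec R. (\<lambda>P\<in>Spec R. f P - g P) P \<in> - {0}}"
    by (rule R.H0_level_idempotent)
  have ec: "e \<in> carrier R"
    using e(1) by (simp add: idempotents_def)
  have D: "basic_open R e = {P \<in> Spec R. f P \<noteq> g P}"
    using e(2) by auto
  \<comment> \<open>A point of D(\<phi> e) would map to a point where \<open>f\<close> and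
    \<open>g\<close> differ, contrary to the equality of their images.\<close>
  have "P \<notin> basic_open R' (\<phi> e)" if P: "P \<in> Spec R'" for P
    using basic_open_preimage[OF R R' \<phi> ec P] D fun_cong[OF eq, of P] P by (simp add: H0_map_def)
  then have "basic_open R' (\<phi> e) = {}"
    by (auto simp: basic_open_def)
  then have "\<phi> e = \<zero>\<^bsub>R'\<^esub>"
    by (rule R'.idempotent_eq_zero_if_basic_open_empty[OF hom_idempotent[OF e(1)]])
  then have "basic_open R e = {}"
    using ker[OF e(1)] R.basic_open_zero by simp
  then show "f = g"
    using D by (intro R.H0_eqI f g) auto
qed

end

theorem theorem5p2:
  fixes R :: "('a, 'm) ring_scheme" and R' :: "('b, 'n) ring_scheme" and \<phi> :: "'a \<Rightarrow> 'b"
  assumes "cring R" and "cring R'" and "\<phi> \<in> ring_hom R R'"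
  shows "(lifts_idempotents R R' \<phi> \<longleftrightarrow>
            H0_map R R' \<phi> ` carrier (H0 R) = carrier (H0 R')) \<and>
         (inj_on (H0_map R R' \<phi>) (carrier (H0 R)) \<longleftrightarrow>
            \<not> (\<exists>e \<in> a_kernel R R' \<phi>. e \<in> idempotents R \<and> e \<noteq> \<zero>\<^bsub>R\<^esub>))"
proof
  show "lifts_idempotents R R' \<phi> \<longleftrightarrow> H0_map R R' \<phi> ` carrier (H0 R) = carrier (H0 R')"
    \<comment> \<open>\<open>H0_map_closed\<close> supplies the inclusion of the image in
      \<open>carrier (H0 R')\<close>; only the reverse inclusion depends on lifting.\<close>
    using H0_map_surj_if_lifts[OF assms] lifts_if_H0_map_surj[OF assms] H0_map_closed[OF assms]
    by blast
  show "inj_on (H0_map R R' \<phi>) (carrier (H0 R)) \<longleftrightarrow>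
      \<not> (\<exists>e \<in> a_kernel R R' \<phi>. e \<in> idempotents R \<and> e \<noteq> \<zero>\<^bsub>R\<^esub>)"
  proof
    assume "inj_on (H0_map R R' \<phi>) (carrier (H0 R))"
    from kernel_idempotent_eq_zero[OF assms this]
    show "\<not> (\<exists>e \<in> a_kernel R R' \<phi>. e \<in> idempotents R \<and> e \<noteq> \<zero>\<^bsub>R\<^esub>)"
      by (auto simp: a_kernel_def')
  next
    assume ker: "\<not> (\<exists>e \<in> a_kernel R R' \<phi>. e \<in> idempotents R \<and> e \<noteq> \<zero>\<^bsub>R\<^esub>)"
    show "inj_on (H0_map R R' \<phi>) (carrier (H0 R))"
    proof (rule H0_map_inj_if_kernel_idempotents_zero[OF assms])
      fix e assume e: "e \<in> idempotents R" "\<phi> e = \<zero>\<^bsub>R'\<^esub>"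
      then have "e \<in> a_kernel R R' \<phi>"
        by (simp add: a_kernel_def' idempotents_def)
      with e(1) ker show "e = \<zero>\<^bsub>R\<^esub>"
        by blast
    qed
  qed
qed

end
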